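(* The product AHI cone is not contained in the cone of scaled diagonally dominant sums of squares: $\Pi_{\mathrm{AHI}}\not\subseteq\mathrm{SDSOS}$. That is, there exist $n$ and a polynomial in $n$ variables belonging to $\Pi_{\mathrm{AHI}}$ but not to $\mathrm{SDSOS}$.
   Context: AHI polynomials: a polynomial in $n$ variables is an AHI polynomial if it has the form $p(x)=\big(\sum_{i=1}^n \lambda_i x^{\alpha(i)}\big)\big(\sum_{i=1}^n \lambda_i \prod_{j\neq i} x^{\alpha(j)}\big)-c\prod_{i=1}^n x^{\alpha(i)}$ with $\lambda_i\ge 0$, $c\in\mathbb{R}$, and each $x^{\alpha(i)}$ a squared monomial in $x_1,\dots,x_n$ (all exponents even non-negative integers; the constant monomial $1$ is allowed). $\mathrm{AHI}$ is the set of those that are non-negative on $\mathbb{R}^n$. The product AHI cone $\Pi_{\mathrm{AHI}}$ (in $n$ variables) is the conic hull (set of finite non-negative linear combinations) of all finite products $\prod_{l=1}^k p_l$ with $k\in\mathbb{N}$, $p_1,\dots,p_k\in\mathrm{AHI}$. $\mathrm{SDSOS}$ is the cone of polynomials $f$ admitting a Gram matrix $G$ (a symmetric matrix with $f=v^TGv$, $v$ a vector of distinct monomials) for which $DGD$ is diagonally dominant (each diagonal entry is at least the sum of absolute values of the other entries in its row) for some positive diagonal matrix $D$; equivalently, $\mathrm{SDSOS}$ is the cone of sums of binomial squares, i.e. finite sums of polynomials $(a\,x^{\beta}+b\,x^{\gamma})^2$ with $a,b\in\mathbb{R}$ and $x^\beta,x^\gamma$ monomials. *)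

theory Defs
  imports Complex_Main "HOL-Library.Poly_Mapping" "Jordan_Normal_Form.Matrix"
begin

text \<open>
  A monomial is given by its finitely supported exponent map, a real polynomial by its finitely
  supported map from monomials to coefficients; addition and multiplication of polynomials are
  those of \<^theory>\<open>HOL-Library.Poly_Mapping\<close> (convolution product). The variables are indexed by
  natural numbers, and those of a polynomial in n variables are x_1, ..., x_n.
\<close>

type_synonym monomial = "nat \<Rightarrow>\<^sub>0 nat"
type_synonym rpoly = "monomial \<Rightarrow>\<^sub>0 real"

definition monomials :: "nat \<Rightarrow> monomial set" where
  "monomials n = {m. Poly_Mapping.keys m \<subseteq> {1..n}}"

definition squared_monomials :: "nat \<Rightarrow> monomial set" where
  "squared_monomials n = {m \<in> monomials n. \<forall>i. even (Poly_Mapping.lookup m i)}"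

definition xpow :: "monomial \<Rightarrow> rpoly" where
  "xpow m = Poly_Mapping.single m 1"

definition const :: "real \<Rightarrow> rpoly" where
  "const c = Poly_Mapping.single 0 c"

definition poly_eval :: "rpoly \<Rightarrow> (nat \<Rightarrow> real) \<Rightarrow> real" where
  "poly_eval p x = (\<Sum>m \<in> Poly_Mapping.keys p. Poly_Mapping.lookup p m *
      (\<Prod>i \<in> Poly_Mapping.keys m. x i ^ Poly_Mapping.lookup m i))"

text \<open>The number of terms in an AHI polynomial equals the number n of variables.\<close>

definition AHI_form :: "nat \<Rightarrow> (nat \<Rightarrow> real) \<Rightarrow> (nat \<Rightarrow> monomial) \<Rightarrow> real \<Rightarrow> rpoly" where
  "AHI_form n lam \<alpha> c =
     (\<Sum>i\<in>{1..n}. const (lam i) * xpow (\<alpha> i)) *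
     (\<Sum>i\<in>{1..n}. const (lam i) * (\<Prod>j\<in>{1..n} - {i}. xpow (\<alpha> j)))
     - const c * (\<Prod>i\<in>{1..n}. xpow (\<alpha> i))"

definition AHI_polynomials :: "nat \<Rightarrow> rpoly set" where
  "AHI_polynomials n = {AHI_form n lam \<alpha> c | lam \<alpha> c.
     \<forall>i\<in>{1..n}. lam i \<ge> 0 \<and> \<alpha> i \<in> squared_monomials n}"

text \<open>
  A point of n-dimensional space is the restriction to {1..n} of a map on all natural numbers;
  the other values do not enter the evaluation of a polynomial in n variables.
\<close>

definition AHI :: "nat \<Rightarrow> rpoly set" where
  "AHI n = {p \<in> AHI_polynomials n. \<forall>x. poly_eval p x \<ge> 0}"

definition conic_hull :: "rpoly set \<Rightarrow> rpoly set" where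
  "conic_hull S = {\<Sum>i<m. const (c i) * q i | (m::nat) c q. \<forall>i<m. c i \<ge> 0 \<and> q i \<in> S}"

definition Pi_AHI :: "nat \<Rightarrow> rpoly set" where
  "Pi_AHI n = conic_hull {\<Prod>l<k. p l | (k::nat) p. \<forall>l<k. p l \<in> AHI n}"

definition diagonally_dominant :: "real mat \<Rightarrow> bool" where
  "diagonally_dominant A \<longleftrightarrow>
     (\<forall>i < dim_row A. A $$ (i, i) \<ge> (\<Sum>j \<in> {..<dim_col A} - {i}. \<bar>A $$ (i, j)\<bar>))"

definition scaled_diagonally_dominant :: "real mat \<Rightarrow> bool" where
  "scaled_diagonally_dominant G \<longleftrightarrow>
     (\<exists>d. (\<forall>i < dim_row G. d i > 0) \<and>
          diagonally_dominant (mat_diag (dim_row G) d * G * mat_diag (dim_row G) d))"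

definition is_gram_matrix :: "monomial list \<Rightarrow> real mat \<Rightarrow> rpoly \<Rightarrow> bool" where
  "is_gram_matrix ms G f \<longleftrightarrow>
     G \<in> carrier_mat (length ms) (length ms) \<and> transpose_mat G = G \<and>
     (let v = vec_of_list (map xpow ms) in f = v \<bullet> (map_mat const G *\<^sub>v v))"

definition SDSOS :: "nat \<Rightarrow> rpoly set" where
  "SDSOS n = {f. \<exists>ms G. distinct ms \<and> set ms \<subseteq> monomials n \<and>
     is_gram_matrix ms G f \<and> scaled_diagonally_dominant G}"

end

theory Submission
  imports Defs
begin

text \<open>
  In one variable \<open>x\<close>, the polynomial \<open>(x\<^sup>2 - 1)\<^sup>2 = (x\<^sup>2 + 1) (1 + x\<^sup>2) - 4 x\<^sup>2\<close> is a non-negative AHI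
  polynomial with the two squared monomials \<open>x\<^sup>2\<close> and \<open>1\<close> (hence \<open>n = 2\<close>; the second variable does
  not occur). Its square \<open>(x\<^sup>2 - 1)\<^sup>4\<close> is therefore in the product cone. It vanishes to order
  four at \<open>x = 1\<close>, and in a sum of squares equal to it every summand would have to do the same;
  but a non-zero binomial square in \<open>x\<close> that vanishes at \<open>x = 1\<close> does so to order two only.

  The proof replaces this local argument by a separating linear functional \<open>L\<close>. If the
  values of \<open>L\<close> on monomials satisfy the Cauchy-Schwarz inequalities
  \<open>L(m m')\<^sup>2 \<le> L(m\<^sup>2) L(m'\<^sup>2)\<close> and \<open>L(m\<^sup>2) \<ge> 0\<close>, then \<open>L\<close> is non-negative on every binomial square,
  and so on SDSOS (\<open>linear_extension_SDSOS_nonneg\<close>). In one variable the inequalities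
  say that the moments \<open>w\<^sub>k = L(x\<^sup>k)\<close> satisfy \<open>w\<^bsub>i+j\<^esub>\<^sup>2 \<le> w\<^bsub>2i\<^esub> w\<^bsub>2j\<^esub>\<close>, a log-convexity that leaves
  room for sequences that do not come from a measure. With the kinked weights \<open>w\<^sub>k = r\<^bsup>\<bar>k - 4\<bar>\<^esup>\<close>, centred
  at the middle exponent, \<open>u = r\<^sup>2\<close> yields
  \<open>L((x\<^sup>2 - 1)\<^sup>4) = 2 u\<^sup>2 - 8 u + 6 = 2 (u - 1) (u - 3)\<close>, which is negative for \<open>1 < u < 3\<close>.
\<close>

section \<open>Linear functionals given by their values on monomials\<close>

definition linear_extension :: "(monomial \<Rightarrow> real) \<Rightarrow> rpoly \<Rightarrow> real" where
  "linear_extension \<phi> p = (\<Sum>m \<in> Poly_Mapping.keys p. Poly_Mapping.lookup p m * \<phi> m)"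

text \<open>
  Summing over an arbitrary finite superset of the support allows the supports of two polynomials
  to be compared with that of their sum, which cancellation can make smaller.
\<close>

lemma linear_extension_superset:
  assumes "finite S" "Poly_Mapping.keys p \<subseteq> S"
  shows "linear_extension \<phi> p = (\<Sum>m \<in> S. Poly_Mapping.lookup p m * \<phi> m)"
  unfolding linear_extension_def
  by (rule sum.mono_neutral_left) (use assms in \<open>auto simp: in_keys_iff\<close>)

lemma linear_extension_add:
  "linear_extension \<phi> (p + q) = linear_extension \<phi> p + linear_extension \<phi> q"
proof -
  let ?S = "Poly_Mapping.keys p \<union> Poly_Mapping.keys q"
  have "linear_extension \<phi> (p + q) = (\<Sum>m \<in> ?S. Poly_Mapping.lookup (p + q) m * \<phi> m)"
    by (rule linear_extension_superset) (auto simp: keys_add)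
  also have "\<dots> = (\<Sum>m \<in> ?S. Poly_Mapping.lookup p m * \<phi> m) + (\<Sum>m \<in> ?S. Poly_Mapping.lookup q m * \<phi> m)"
    by (simp add: lookup_add distrib_right sum.distrib)
  also have "\<dots> = linear_extension \<phi> p + linear_extension \<phi> q"
    by (simp add: linear_extension_superset[of ?S])
  finally show ?thesis .
qed

lemma linear_extension_sum:
  "linear_extension \<phi> (\<Sum>i\<in>I. p i) = (\<Sum>i\<in>I. linear_extension \<phi> (p i))"
proof (induction I rule: infinite_finite_induct)
  case (insert i I)
  then show ?case by (simp add: linear_extension_add)
qed (auto simp: linear_extension_def)

lemma linear_extension_const_mult_xpow:
  "linear_extension \<phi> (const c * xpow m) = c * \<phi> m"
  by (simp add: linear_extension_def const_def xpow_def mult_single)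

lemma poly_eval_eq_linear_extension:
  "poly_eval p x =
     linear_extension (\<lambda>m. \<Prod>i \<in> Poly_Mapping.keys m. x i ^ Poly_Mapping.lookup m i) p"
  by (simp add: poly_eval_def linear_extension_def)

lemma xpow_mult: "xpow a * xpow b = xpow (a + b)"
  by (simp add: xpow_def mult_single)

section \<open>Non-negativity on SDSOS\<close>

text \<open>
  Diagonal dominance bounds the form from below by
  \<open>\<Sum>i. \<Sum>j\<noteq>i. \<bar>A i j\<bar> (y i\<^sup>2 - y i y j)\<close>, and symmetrising in \<open>i\<close> and \<open>j\<close> turns the summand into
  \<open>\<bar>A i j\<bar> (y i - y j)\<^sup>2 / 2\<close>. As the off-diagonal entries enter through absolute values only, the
  products \<open>y i * y j\<close> there can be replaced by anything smaller in absolute value; this is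
  what distinguishes diagonal dominance from positive semidefiniteness.
\<close>

lemma diagonally_dominant_form_nonneg:
  fixes A M :: "nat \<Rightarrow> nat \<Rightarrow> real" and y :: "nat \<Rightarrow> real"
  assumes sym: "\<And>i j. i < N \<Longrightarrow> j < N \<Longrightarrow> A i j = A j i"
    and dom: "\<And>i. i < N \<Longrightarrow> (\<Sum>j\<in>{..<N} - {i}. \<bar>A i j\<bar>) \<le> A i i"
    and diag: "\<And>i. i < N \<Longrightarrow> M i i = y i ^ 2"
    and off: "\<And>i j. i < N \<Longrightarrow> j < N \<Longrightarrow> \<bar>M i j\<bar> \<le> y i * y j"
  shows "0 \<le> (\<Sum>i<N. \<Sum>j<N. A i j * M i j)"
proof -
  let ?B = "\<lambda>i j. \<bar>A i j\<bar> * (y i ^ 2 - y i * y j)"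
  have row: "(\<Sum>j<N. ?B i j) \<le> (\<Sum>j<N. A i j * M i j)" if i: "i < N" for i
  proof -
    have "(\<Sum>j<N. ?B i j) = (\<Sum>j\<in>{..<N} - {i}. ?B i j)"
      using i by (simp add: sum.remove[of _ i] power2_eq_square)
    also have "\<dots> = (\<Sum>j\<in>{..<N} - {i}. \<bar>A i j\<bar>) * y i ^ 2 - (\<Sum>j\<in>{..<N} - {i}. \<bar>A i j\<bar> * (y i * y j))"
      by (simp add: sum_distrib_right right_diff_distrib sum_subtractf)
    also have "\<dots> \<le> A i i * y i ^ 2 + (\<Sum>j\<in>{..<N} - {i}. A i j * M i j)"
    proof -
      have "- (\<bar>A i j\<bar> * (y i * y j)) \<le> A i j * M i j" if j: "j < N" for j
      proof -
        have "\<bar>A i j * M i j\<bar> \<le> \<bar>A i j\<bar> * (y i * y j)"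
          unfolding abs_mult by (intro mult_left_mono off i j) auto
        then show ?thesis by linarith
      qed
      then have "(\<Sum>j\<in>{..<N} - {i}. - (\<bar>A i j\<bar> * (y i * y j))) \<le> (\<Sum>j\<in>{..<N} - {i}. A i j * M i j)"
        by (intro sum_mono) auto
      moreover have "(\<Sum>j\<in>{..<N} - {i}. \<bar>A i j\<bar>) * y i ^ 2 \<le> A i i * y i ^ 2"
        by (intro mult_right_mono dom i) auto
      ultimately show ?thesis by (simp add: sum_negf)
    qed
    also have "\<dots> = (\<Sum>j<N. A i j * M i j)"
      using i diag[OF i] by (simp add: sum.remove[of _ i])
    finally show ?thesis .
  qed
  have "2 * (\<Sum>i<N. \<Sum>j<N. ?B i j) = (\<Sum>i<N. \<Sum>j<N. ?B i j) + (\<Sum>i<N. \<Sum>j<N. ?B j i)"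
    using sum.swap[of ?B "{..<N}" "{..<N}"] by simp
  also have "\<dots> = (\<Sum>i<N. \<Sum>j<N. \<bar>A i j\<bar> * (y i - y j) ^ 2)"
    unfolding sum.distrib[symmetric]
    by (intro sum.cong refl) (use sym in \<open>auto simp: power2_eq_square algebra_simps\<close>)
  also have "\<dots> \<ge> 0" by (intro sum_nonneg) auto
  finally have "0 \<le> (\<Sum>i<N. \<Sum>j<N. ?B i j)" by simp
  also have "\<dots> \<le> (\<Sum>i<N. \<Sum>j<N. A i j * M i j)"
    by (intro sum_mono row) auto
  finally show ?thesis .
qed

lemma linear_extension_gram_matrix:
  assumes "is_gram_matrix ms G f"
  shows "linear_extension \<phi> f =
    (\<Sum>i<length ms. \<Sum>j<length ms. G $$ (i, j) * \<phi> (ms ! i + ms ! j))"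
proof -
  let ?N = "length ms" and ?v = "vec_of_list (map xpow ms)"
  have G: "G \<in> carrier_mat ?N ?N" and f: "f = ?v \<bullet> (map_mat const G *\<^sub>v ?v)"
    using assms by (auto simp: is_gram_matrix_def Let_def)
  have "f = (\<Sum>i<?N. \<Sum>j<?N. xpow (ms ! i) * (const (G $$ (i, j)) * xpow (ms ! j)))"
    unfolding f scalar_prod_def using G
    by (auto simp: atLeast0LessThan scalar_prod_def sum_distrib_left vec_of_list_index intro!: sum.cong)
  also have "\<dots> = (\<Sum>i<?N. \<Sum>j<?N. const (G $$ (i, j)) * xpow (ms ! i + ms ! j))"
    by (simp add: xpow_mult[symmetric] mult_ac)
  finally show ?thesis
    by (simp add: linear_extension_sum linear_extension_const_mult_xpow)
qed

text \<open>
  The scaling by \<open>d\<close> is absorbed by dividing the square root of \<open>\<phi> (2 m\<^sub>i)\<close> by \<open>d i\<close>: the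
  Cauchy-Schwarz inequalities are invariant under rescaling the monomials.
\<close>

lemma linear_extension_SDSOS_nonneg:
  assumes sq: "\<And>m. 0 \<le> \<phi> (m + m)"
    and cs: "\<And>m m'. \<phi> (m + m') ^ 2 \<le> \<phi> (m + m) * \<phi> (m' + m')"
    and f: "f \<in> SDSOS n"
  shows "0 \<le> linear_extension \<phi> f"
proof -
  obtain ms G where gram: "is_gram_matrix ms G f" and sdd: "scaled_diagonally_dominant G"
    using f by (auto simp: SDSOS_def)
  define N where "N = length ms"
  have G: "G \<in> carrier_mat N N" and sym: "transpose_mat G = G"
    using gram by (auto simp: is_gram_matrix_def N_def)
  obtain d where d: "\<And>i. i < N \<Longrightarrow> 0 < d i"
    and dd: "diagonally_dominant (mat_diag N d * G * mat_diag N d)"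
    using sdd G by (auto simp: scaled_diagonally_dominant_def)
  define A where "A = (\<lambda>i j. d i * G $$ (i, j) * d j)"
  define M where "M = (\<lambda>i j. \<phi> (ms ! i + ms ! j) / (d i * d j))"
  define y where "y = (\<lambda>i. sqrt (\<phi> (ms ! i + ms ! i)) / d i)"
  have DGD: "mat_diag N d * G * mat_diag N d = mat N N (\<lambda>(i, j). A i j)"
    using G by (auto simp: A_def mat_diag_mult_left[OF G] mat_diag_mult_right[of _ N N])
  have "0 \<le> (\<Sum>i<N. \<Sum>j<N. A i j * M i j)"
  proof (rule diagonally_dominant_form_nonneg)
    fix i j assume ij: "i < N" "j < N"
    have "G $$ (i, j) = transpose_mat G $$ (i, j)" by (simp add: sym)
    then have "G $$ (i, j) = G $$ (j, i)" using ij G by simp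
    then show "A i j = A j i" by (simp add: A_def)
    have "\<bar>\<phi> (ms ! i + ms ! j)\<bar> \<le> sqrt (\<phi> (ms ! i + ms ! i) * \<phi> (ms ! j + ms ! j))"
      by (rule real_le_rsqrt) (simp add: cs)
    then show "\<bar>M i j\<bar> \<le> y i * y j"
      using d[OF ij(1)] d[OF ij(2)]
      by (simp add: M_def y_def real_sqrt_mult abs_mult divide_right_mono)
  next
    fix i assume i: "i < N"
    show "(\<Sum>j\<in>{..<N} - {i}. \<bar>A i j\<bar>) \<le> A i i"
      using dd i unfolding DGD diagonally_dominant_def by simp
    show "M i i = y i ^ 2"
      by (simp add: M_def y_def power_divide sq power2_eq_square[of "d i"])
  qed
  also have "\<dots> = (\<Sum>i<N. \<Sum>j<N. G $$ (i, j) * \<phi> (ms ! i + ms ! j))"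
  proof (intro sum.cong refl)
    fix i j assume "i \<in> {..<N}" "j \<in> {..<N}"
    then show "A i j * M i j = G $$ (i, j) * \<phi> (ms ! i + ms ! j)"
      using d[of i] d[of j] by (simp add: A_def M_def)
  qed
  also have "\<dots> = linear_extension \<phi> f"
    using linear_extension_gram_matrix[OF gram] by (simp add: N_def)
  finally show ?thesis .
qed

section \<open>The fourth power of \<open>x\<^sup>2 - 1\<close>\<close>

abbreviation x1pow :: "nat \<Rightarrow> rpoly" where
  "x1pow k \<equiv> xpow (Poly_Mapping.single (Suc 0) k)"

lemma x1pow_mult: "x1pow a * x1pow b = x1pow (a + b)"
  by (simp add: xpow_mult single_add)

lemma xpow_0: "xpow 0 = 1"
  by (simp add: xpow_def)

lemma const_numerals:
  "const 1 = 1" "const (numeral k) = numeral k" "const (- numeral k) = - numeral k"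
  by (simp_all add: const_def single_uminus)

lemma square_x1_minus_1_AHI: "(x1pow 2 - 1)\<^sup>2 \<in> AHI 2"
proof -
  define \<alpha> :: "nat \<Rightarrow> monomial" where
    "\<alpha> = (\<lambda>i. if i = 1 then Poly_Mapping.single 1 2 else 0)"
  have I: "{1..2} = {1, 2::nat}" by auto
  have "AHI_form 2 (\<lambda>_. 1) \<alpha> 4 = (x1pow 2 - 1)\<^sup>2"
  proof -
    have "{1, 2} - {1} = {2::nat}" "{1, 2} - {2} = {1::nat}" by auto
    then have "AHI_form 2 (\<lambda>_. 1) \<alpha> 4
        = (x1pow 2 + xpow 0) * (xpow 0 + x1pow 2) - 4 * (x1pow 2 * xpow 0)"
      unfolding AHI_form_def I by (simp add: \<alpha>_def const_numerals)
    also have "\<dots> = (x1pow 2 - 1)\<^sup>2"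
      by (simp add: xpow_0 power2_eq_square algebra_simps)
    finally show ?thesis .
  qed
  moreover have "\<forall>i\<in>{1..2}. (0::real) \<le> 1 \<and> \<alpha> i \<in> squared_monomials 2"
    by (auto simp: \<alpha>_def squared_monomials_def monomials_def lookup_single when_def)
  ultimately have form: "(x1pow 2 - 1)\<^sup>2 \<in> AHI_polynomials 2"
    unfolding AHI_polynomials_def by (smt (verit) mem_Collect_eq)
  have "0 \<le> poly_eval ((x1pow 2 - 1)\<^sup>2) x" for x
  proof -
    have "(x1pow 2 - 1)\<^sup>2 = const 1 * x1pow 4 + const (-2) * x1pow 2 + const 1 * x1pow 0"
      using x1pow_mult[of 2 2] by (simp add: const_numerals xpow_0 power2_eq_square algebra_simps)
    then have "poly_eval ((x1pow 2 - 1)\<^sup>2) x = x 1 ^ 4 - 2 * x 1 ^ 2 + 1"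
      by (simp add: poly_eval_eq_linear_extension linear_extension_add
          linear_extension_const_mult_xpow)
    also have "\<dots> = ((x 1)\<^sup>2 - 1)\<^sup>2" by (simp add: power2_eq_square power4_eq_xxxx algebra_simps)
    also have "\<dots> \<ge> 0" by simp
    finally show ?thesis .
  qed
  with form show ?thesis by (simp add: AHI_def)
qed

lemma product_in_Pi_AHI:
  assumes "p \<in> AHI n" "q \<in> AHI n"
  shows "p * q \<in> Pi_AHI n"
proof -
  have "p * q = (\<Prod>l<2::nat. if l = 0 then p else q)"
    by (simp add: numeral_2_eq_2)
  then have "p * q \<in> {\<Prod>l<k. p l | (k::nat) p. \<forall>l<k. p l \<in> AHI n}" (is "_ \<in> ?S")
    using assms by (auto intro!: exI[of _ 2] exI[of _ "\<lambda>l::nat. if l = 0 then p else q"])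
  moreover have "p * q = (\<Sum>i<1::nat. const 1 * (p * q))"
    by (simp add: const_numerals)
  ultimately show ?thesis
    unfolding Pi_AHI_def conic_hull_def
    by (intro CollectI exI[of _ "1::nat"] exI[of _ "\<lambda>_. 1"] exI[of _ "\<lambda>_. p * q"]) auto
qed

text \<open>
  The base \<open>3/2\<close> has square \<open>u = 9/4\<close> between 1 and 3, the range in which
  \<open>2 (u - 1) (u - 3)\<close> is negative.
\<close>

definition kinked_weight :: "monomial \<Rightarrow> real" where
  "kinked_weight m = (3 / 2) ^ nat \<bar>int (Poly_Mapping.lookup m 1) - 4\<bar>"

text \<open>
  On the exponents of \<open>3/2\<close> the inequality is the midpoint convexity of \<open>k \<mapsto> \<bar>k - 4\<bar>\<close>.
\<close>

lemma kinked_weight_cauchy_schwarz: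
  "kinked_weight (m + m') ^ 2 \<le> kinked_weight (m + m) * kinked_weight (m' + m')"
  unfolding kinked_weight_def power_mult[symmetric] power_add[symmetric] lookup_add
  by (rule power_increasing) auto

lemma fourth_power_not_SDSOS: "(x1pow 2 - 1) ^ 4 \<notin> SDSOS n"
proof
  assume "(x1pow 2 - 1) ^ 4 \<in> SDSOS n"
  then have "0 \<le> linear_extension kinked_weight ((x1pow 2 - 1) ^ 4)"
    by (intro linear_extension_SDSOS_nonneg kinked_weight_cauchy_schwarz)
      (auto simp: kinked_weight_def)
  moreover have "(x1pow 2 - 1) ^ 4 = const 1 * x1pow 8 + const (-4) * x1pow 6
      + const 6 * x1pow 4 + const (-4) * x1pow 2 + const 1 * x1pow 0"
  proof -
    have pows: "x1pow 4 = x1pow 2 ^ 2" "x1pow 6 = x1pow 2 ^ 3" "x1pow 8 = x1pow 2 ^ 4"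
      by (simp_all add: power2_eq_square power3_eq_cube power4_eq_xxxx x1pow_mult)
    show ?thesis
      unfolding pows const_numerals
      by (simp add: xpow_0 power2_eq_square power3_eq_cube power4_eq_xxxx algebra_simps)
  qed
  ultimately show False
    by (simp add: linear_extension_add linear_extension_const_mult_xpow kinked_weight_def
        lookup_single power2_eq_square power4_eq_xxxx)
qed

theorem proposition4p10:
  shows "\<exists>n. \<not> Pi_AHI n \<subseteq> SDSOS n"
proof -
  have "(x1pow 2 - 1) ^ 4 = (x1pow 2 - 1)\<^sup>2 * (x1pow 2 - 1)\<^sup>2"
    by (simp flip: power_add)
  then have "(x1pow 2 - 1) ^ 4 \<in> Pi_AHI 2"
    using product_in_Pi_AHI[OF square_x1_minus_1_AHI square_x1_minus_1_AHI] by simp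
  with fourth_power_not_SDSOS show ?thesis by blast
qed

end
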